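(* Every torsion free abelian group $G$ permits an archimedean directed order, i.e. there is a partial order $\le$ on $G$ making $G$ a partially ordered group such that $(G,\le)$ is a directed set and $(G,\le)$ is archimedean.
   Context: A partially ordered abelian group is an abelian group with a partial order $\le$ such that $a\le b$ implies $a+x\le b+x$ for all $x$. Its order is directed if any two elements have a common upper bound. An element $a\ge 0$ is called infinitesimal with respect to another element $b$ if $na\le b$ for every integer $n\in\mathbb{Z}$. The partially ordered group is called archimedean if no element other than $0$ is infinitesimal with respect to another element. *)

theory Defs
  imports "HOL-Algebra.Algebra"
begin

text \<open>
  Groups are written multiplicatively, as usual in \<open>HOL-Algebra\<close>: \<open>a + x\<close> is
  \<open>a \<otimes> x\<close>, the integer multiple \<open>n a\<close> is \<open>a [^] n\<close>, and \<open>0\<close> is \<open>\<one>\<close>.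
  An order on \<open>G\<close> is a relation \<open>r\<close>, with \<open>(a, b) \<in> r\<close> for \<open>a \<le> b\<close>.
\<close>

definition torsion_free :: "('a, 'b) monoid_scheme \<Rightarrow> bool" where
  "torsion_free G \<longleftrightarrow>
    (\<forall>x\<in>carrier G. \<forall>n::nat. n > 0 \<and> x [^]\<^bsub>G\<^esub> n = \<one>\<^bsub>G\<^esub> \<longrightarrow> x = \<one>\<^bsub>G\<^esub>)"

locale po_comm_group = comm_group G
  for G :: "('a, 'b) monoid_scheme" (structure) +
  fixes r :: "'a rel"
  assumes partial_order: "partial_order_on (carrier G) r"
    and translation:
      "\<lbrakk>a \<in> carrier G; b \<in> carrier G; x \<in> carrier G; (a, b) \<in> r\<rbrakk> \<Longrightarrow> (a \<otimes> x, b \<otimes> x) \<in> r"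

definition directed_order_on :: "'a set \<Rightarrow> 'a rel \<Rightarrow> bool" where
  "directed_order_on A r \<longleftrightarrow> (\<forall>a\<in>A. \<forall>b\<in>A. \<exists>c\<in>A. (a, c) \<in> r \<and> (b, c) \<in> r)"

definition infinitesimal_wrt :: "('a, 'b) monoid_scheme \<Rightarrow> 'a rel \<Rightarrow> 'a \<Rightarrow> 'a \<Rightarrow> bool" where
  "infinitesimal_wrt G r a b \<longleftrightarrow> (\<one>\<^bsub>G\<^esub>, a) \<in> r \<and> (\<forall>n::int. (a [^]\<^bsub>G\<^esub> n, b) \<in> r)"

definition archimedean_order :: "('a, 'b) monoid_scheme \<Rightarrow> 'a rel \<Rightarrow> bool" where
  "archimedean_order G r \<longleftrightarrow>
    (\<forall>a\<in>carrier G. \<forall>b\<in>carrier G. infinitesimal_wrt G r a b \<longrightarrow> a = \<one>\<^bsub>G\<^esub>)"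

end

theory Submission
  imports Defs
begin

text \<open>
  A torsion-free abelian group \<open>G\<close> embeds into the rational vector space spanned by a maximal
  independent subset \<open>B\<close> of \<open>G\<close>: some positive power of each \<open>a\<close> is an integral combination
  of \<open>B\<close>, and dividing the coefficients by the exponent gives rational coordinates of \<open>a\<close>.
  The order that works is the coordinatewise one.

  It is archimedean because \<open>\<rat>\<close> is: if \<open>n a \<le> b\<close> for all \<open>n\<close>, then every coordinate of \<open>a\<close>
  vanishes, so \<open>a\<close> is trivial (lemma \<open>coordinatewise_order\<close>).
  Directedness is the delicate point, since a coordinatewise upper bound formed in the vector
  space need not lie in \<open>G\<close>.  It holds because \<open>G\<close> contains every integral combination of \<open>B\<close>:
  if \<open>n > 0\<close> and the \<open>n\<close>-th power of \<open>a\<close> has coefficients \<open>c\<close>, then the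
  coordinates of \<open>a\<close> are \<open>c x / n\<close>, and the element of \<open>G\<close> with coordinates \<open>\<bar>c x\<bar>\<close> dominates
  \<open>a\<close> (lemma \<open>rational_coordinates\<close>).
\<close>

text \<open>
  Elements of \<open>S\<close> are regarded as generators through \<open>h\<close>, so that \<open>h c = \<one>\<close> expresses a linear
  relation.  A relation involves finitely many generators, hence independence passes to unions of
  chains, and Zorn's lemma gives a maximal independent \<open>B\<close>.  If \<open>x\<close> is outside \<open>B\<close>, a nontrivial
  relation on \<open>insert x B\<close> has a nonzero coefficient at \<open>x\<close> and can be solved for a power of \<open>x\<close>.
\<close>

lemma (in comm_group) maximal_independent_subset:
  assumes h: "h \<in> hom (free_Abelian_group S) G"
  obtains B where "B \<subseteq> S"
    and "\<And>c. Poly_Mapping.keys c \<subseteq> B \<Longrightarrow> h c = \<one> \<Longrightarrow> c = 0"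
    and "\<And>x. x \<in> S \<Longrightarrow>
      \<exists>n>0. \<exists>c. Poly_Mapping.keys c \<subseteq> B \<and> h (frag_of x) [^] (n::int) = h c"
proof -
  interpret h: group_hom "free_Abelian_group S" G h
    by (simp add: h group_hom_axioms_def group_hom_def)
  define indep where
    "indep = {B. B \<subseteq> S \<and> (\<forall>c. Poly_Mapping.keys c \<subseteq> B \<longrightarrow> h c = \<one> \<longrightarrow> c = 0)}"
  have "\<exists>B\<in>indep. \<forall>A\<in>indep. B \<subseteq> A \<longrightarrow> A = B"
  proof (rule subset_Zorn_nonempty)
    show "indep \<noteq> {}"
      by (auto simp: indep_def intro!: exI[of _ "{}"])
  next
    fix \<C> assume "\<C> \<noteq> {}" and chain: "subset.chain indep \<C>"
    have "c = 0" if c: "Poly_Mapping.keys c \<subseteq> \<Union>\<C>" "h c = \<one>" for c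
    proof -
      obtain B where "B \<in> \<C>" "Poly_Mapping.keys c \<subseteq> B"
        using finite_subset_Union_chain[OF finite_keys c(1) \<open>\<C> \<noteq> {}\<close> chain] .
      moreover have "\<C> \<subseteq> indep"
        using chain by (simp add: subset.chain_def)
      ultimately show ?thesis
        using c(2) unfolding indep_def by blast
    qed
    moreover have "\<Union>\<C> \<subseteq> S"
      using chain by (auto simp: subset.chain_def indep_def)
    ultimately show "\<Union>\<C> \<in> indep"
      by (simp add: indep_def)
  qed
  then obtain B where B: "B \<in> indep" and max: "\<And>A. A \<in> indep \<Longrightarrow> B \<subseteq> A \<Longrightarrow> A = B"
    by blast
  have BS: "B \<subseteq> S" and ind: "\<And>c. Poly_Mapping.keys c \<subseteq> B \<Longrightarrow> h c = \<one> \<Longrightarrow> c = 0"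
    using B by (auto simp: indep_def)
  have "\<exists>n>0. \<exists>c. Poly_Mapping.keys c \<subseteq> B \<and> h (frag_of x) [^] (n::int) = h c" if x: "x \<in> S" for x
  proof (cases "x \<in> B")
    case True
    then show ?thesis
      using x by (intro exI[of _ 1] conjI exI[of _ "frag_of x"]) (auto simp: int_pow_1)
  next
    case False
    then have "insert x B \<notin> indep"
      using max by blast
    then obtain c where c: "Poly_Mapping.keys c \<subseteq> insert x B" "h c = \<one>" "c \<noteq> 0"
      using x BS by (auto simp: indep_def)
    define k where "k = Poly_Mapping.lookup c x"
    define d where "d = c - frag_cmul k (frag_of x)"
    have d: "Poly_Mapping.keys d \<subseteq> B"
    proof
      fix y assume "y \<in> Poly_Mapping.keys d"
      then have "Poly_Mapping.lookup c y \<noteq> 0 \<and> y \<noteq> x"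
        by (auto simp: in_keys_iff d_def k_def Poly_Mapping.lookup_minus lookup_frag_of
            split: if_splits)
      then show "y \<in> B"
        using c(1) by (auto simp: in_keys_iff)
    qed
    have "k \<noteq> 0"
      using ind c d by (auto simp: d_def)
    have dS: "Poly_Mapping.keys d \<subseteq> S"
      using d BS by blast
    have xS: "frag_of x \<in> carrier (free_Abelian_group S)"
      using x by simp
    have pow: "h (frag_cmul j (frag_of x)) = h (frag_of x) [^] j" for j :: int
      using h.hom_int_pow[OF xS, of j] x by simp
    have "h d \<otimes> h (frag_of x) [^] k = h (d + frag_cmul k (frag_of x))"
    proof -
      have "Poly_Mapping.keys (frag_cmul k (frag_of x)) \<subseteq> S"
        using x keys_cmul[of k "frag_of x"] by auto
      then show ?thesis
        using h.hom_mult[of d "frag_cmul k (frag_of x)"] dS by (simp add: pow)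
    qed
    also have "\<dots> = \<one>"
      using c(2) by (simp add: d_def)
    finally have rel: "h d \<otimes> h (frag_of x) [^] k = \<one>" .
    have hd: "h d \<in> carrier G" and hx: "h (frag_of x) \<in> carrier G"
      using dS x by (auto intro!: h.hom_closed)
    have neg: "h (- d) = inv (h d)"
      using h.hom_inv[of d] dS by simp
    \<comment> \<open>Solving \<open>rel\<close> for the power of \<open>x\<close>, inverted if necessary to make the exponent positive.\<close>
    show ?thesis
    proof (cases "k > 0")
      case True
      have "h (frag_of x) [^] k = h (- d)"
        unfolding neg using rel hd hx by (metis inv_equality int_pow_closed m_comm)
      then show ?thesis
        using True d by (intro exI[of _ k] conjI exI[of _ "- d"]) auto
    next
      case False
      have "h (frag_of x) [^] (- k) = h d"
        using rel hd hx by (metis inv_equality int_pow_closed int_pow_neg)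
      then show ?thesis
        using False \<open>k \<noteq> 0\<close> d by (intro exI[of _ "- k"] conjI exI[of _ d]) auto
    qed
  qed
  then show ?thesis
    using that BS ind by blast
qed

text \<open>
  Every \<open>a\<close> has a positive power that is an integral combination of a maximal independent set
  \<open>B\<close>; its coefficients divided by the exponent do not depend on the choice of the power, and
  they are additive because two elements can be brought to a common exponent.  Torsion-freeness
  enters in the separation of points: when all coefficients vanish, a positive power of \<open>a\<close> is
  trivial.  The last conclusion records, in the form used for directedness, that all integral
  combinations of \<open>B\<close> belong to \<open>G\<close>.
\<close>

lemma (in comm_group) rational_coordinates:
  assumes "torsion_free G"
  obtains \<phi> :: "'a \<Rightarrow> 'a \<Rightarrow> rat"
  where "\<And>a b x. a \<in> carrier G \<Longrightarrow> b \<in> carrier G \<Longrightarrow> \<phi> (a \<otimes> b) x = \<phi> a x + \<phi> b x"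
    and "\<And>a. a \<in> carrier G \<Longrightarrow> (\<And>x. \<phi> a x = 0) \<Longrightarrow> a = \<one>"
    and "\<And>a. a \<in> carrier G \<Longrightarrow> \<exists>c\<in>carrier G. \<forall>x. \<bar>\<phi> a x\<bar> \<le> \<phi> c x"
proof -
  let ?F = "free_Abelian_group (carrier G)"
  obtain h where h: "h \<in> hom ?F G" and h_of: "\<And>x. x \<in> carrier G \<Longrightarrow> h (frag_of x) = x"
    using free_Abelian_group_universal[of "\<lambda>x. x" "carrier G"] by auto
  interpret h: group_hom ?F G h
    by (simp add: h group_hom_axioms_def group_hom_def)
  obtain B where BG: "B \<subseteq> carrier G"
    and ind: "\<And>c. Poly_Mapping.keys c \<subseteq> B \<Longrightarrow> h c = \<one> \<Longrightarrow> c = 0"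
    and span: "\<And>a. a \<in> carrier G \<Longrightarrow>
      \<exists>n>0. \<exists>c. Poly_Mapping.keys c \<subseteq> B \<and> h (frag_of a) [^] (n::int) = h c"
    using maximal_independent_subset[OF h] by metis
  define repr where
    "repr a n c \<longleftrightarrow> n > 0 \<and> Poly_Mapping.keys c \<subseteq> B \<and> a [^] (n::int) = h c" for a n c
  have ex_repr: "\<exists>n c. repr a n c" if "a \<in> carrier G" for a
    using span[OF that] h_of[OF that] by (auto simp: repr_def)
  have keys_G: "Poly_Mapping.keys c \<subseteq> B \<Longrightarrow> Poly_Mapping.keys c \<subseteq> carrier G" for c :: "'a \<Rightarrow>\<^sub>0 int"
    using BG by blast
  have h_cmul: "h (frag_cmul n c) = h c [^] n" if "Poly_Mapping.keys c \<subseteq> B" for n c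
    using h.hom_int_pow[of c n] keys_G[OF that] by simp
  have keys_cmul_B: "Poly_Mapping.keys (frag_cmul n c) \<subseteq> B" if "Poly_Mapping.keys c \<subseteq> B" for n c
    using keys_cmul[of n c] that by blast
  have h_inj: "c = d" if "Poly_Mapping.keys c \<subseteq> B" "Poly_Mapping.keys d \<subseteq> B" "h c = h d" for c d
  proof -
    have "h (c + - d) = h c \<otimes> inv (h d)"
      using h.hom_mult[of c "- d"] h.hom_inv[of d] keys_G[OF that(1)] keys_G[OF that(2)] by simp
    also have "\<dots> = \<one>"
      using that(3) keys_G[OF that(2)] h.hom_closed[of d] by simp
    finally have "h (c - d) = \<one>"
      by simp
    then have "c - d = 0"
      using that keys_diff[of c d] by (intro ind) auto
    then show ?thesis by simp
  qed
  define \<phi> :: "'a \<Rightarrow> 'a \<Rightarrow> rat" where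
    "\<phi> a x = (let (n, c) = (SOME (n, c). repr a n c) in of_int (Poly_Mapping.lookup c x) / of_int n)"
    for a x
  \<comment> \<open>Cross-multiplying two representations of \<open>a\<close> gives the same combination of \<open>B\<close>.\<close>
  have \<phi>: "\<phi> a x = of_int (Poly_Mapping.lookup c x) / of_int n"
    if a: "a \<in> carrier G" and r: "repr a n c" for a n c x
  proof -
    obtain m d where md: "(SOME (n, c). repr a n c) = (m, d)"
      by fastforce
    have "case (SOME (n, c). repr a n c) of (n, c) \<Rightarrow> repr a n c"
      by (rule someI[of _ "(n, c)"]) (simp add: r)
    then have r': "repr a m d"
      by (simp add: md)
    have "h (frag_cmul m c) = h (frag_cmul n d)"
    proof -
      have "(a [^] n) [^] m = (a [^] m) [^] n"
        using a by (simp add: int_pow_pow mult.commute)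
      then show ?thesis
        using r r' by (simp add: repr_def h_cmul)
    qed
    then have "frag_cmul m c = frag_cmul n d"
      using r r' by (intro h_inj keys_cmul_B) (auto simp: repr_def)
    then have "Poly_Mapping.lookup (frag_cmul m c) x = Poly_Mapping.lookup (frag_cmul n d) x"
      by simp
    then have "m * Poly_Mapping.lookup c x = n * Poly_Mapping.lookup d x"
      by simp
    then have "(of_int m :: rat) * of_int (Poly_Mapping.lookup c x)
        = of_int n * of_int (Poly_Mapping.lookup d x)"
      by (metis of_int_mult)
    moreover have "n > 0" "m > 0"
      using r r' by (simp_all add: repr_def)
    ultimately show ?thesis
      by (simp add: \<phi>_def md field_simps)
  qed
  show ?thesis
  proof (rule that[of \<phi>])
    fix a b x assume ab: "a \<in> carrier G" "b \<in> carrier G"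
    obtain n c m d where r: "repr a n c" "repr b m d"
      using ex_repr ab by metis
    let ?e = "frag_cmul m c + frag_cmul n d"
    have keys: "Poly_Mapping.keys (frag_cmul m c) \<subseteq> B" "Poly_Mapping.keys (frag_cmul n d) \<subseteq> B"
      using r by (auto simp: repr_def intro!: keys_cmul_B del: subsetI)
    have "(a \<otimes> b) [^] (n * m) = (a [^] n) [^] m \<otimes> (b [^] m) [^] n"
      using ab by (simp add: int_pow_distrib int_pow_pow mult.commute)
    also have "\<dots> = h ?e"
      using r h.hom_mult[of "frag_cmul m c" "frag_cmul n d"] keys_G[OF keys(1)] keys_G[OF keys(2)]
      by (simp add: repr_def h_cmul)
    finally have "repr (a \<otimes> b) (n * m) ?e"
      using r keys keys_add[of "frag_cmul m c" "frag_cmul n d"] by (auto simp: repr_def)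
    then show "\<phi> (a \<otimes> b) x = \<phi> a x + \<phi> b x"
      using r ab by (simp add: \<phi>[of _ "n * m" ?e] \<phi>[of _ n c] \<phi>[of _ m d] Poly_Mapping.lookup_add)
        (simp add: repr_def field_simps)
  next
    fix a assume a: "a \<in> carrier G" and 0: "\<And>x. \<phi> a x = 0"
    obtain n c where r: "repr a n c"
      using ex_repr a by metis
    have "c = 0"
    proof (rule poly_mapping_eqI)
      show "Poly_Mapping.lookup c x = Poly_Mapping.lookup 0 x" for x
        using 0[of x] \<phi>[OF a r, of x] r by (simp add: repr_def)
    qed
    then have "a [^] n = \<one>"
      using r h.hom_one by (simp add: repr_def)
    then have "a [^] nat n = \<one>"
      using r int_pow_int[of G a "nat n"] by (simp add: repr_def)
    moreover have "nat n > 0"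
      using r by (simp add: repr_def)
    ultimately show "a = \<one>"
      using a assms unfolding torsion_free_def by blast
  next
    fix a assume a: "a \<in> carrier G"
    obtain n c where r: "repr a n c"
      using ex_repr a by metis
    \<comment> \<open>Dividing by \<open>n \<ge> 1\<close> only shrinks a coefficient, so the undivided absolute values dominate.\<close>
    define d where "d = Poly_Mapping.map abs c"
    have d: "Poly_Mapping.lookup d x = \<bar>Poly_Mapping.lookup c x\<bar>" for x
      by (simp add: d_def Poly_Mapping.map.rep_eq when_def)
    have dB: "Poly_Mapping.keys d \<subseteq> B"
      using r by (auto simp: repr_def in_keys_iff d)
    have hd: "h d \<in> carrier G"
      using keys_G[OF dB] h.hom_closed[of d] by simp
    have "repr (h d) 1 d"
      using dB hd by (simp add: repr_def)
    moreover have "\<bar>of_int k / of_int n :: rat\<bar> \<le> of_int \<bar>k\<bar>" for k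
    proof -
      have "of_int \<bar>k\<bar> * (1 :: rat) \<le> of_int \<bar>k\<bar> * of_int n"
        using r by (intro mult_left_mono) (auto simp: repr_def)
      then show ?thesis
        using r by (simp add: repr_def abs_divide divide_le_eq)
    qed
    ultimately have "\<bar>\<phi> a x\<bar> \<le> \<phi> (h d) x" for x
      using \<phi>[OF a r, of x] \<phi>[OF hd, of 1 d x] by (simp add: d)
    then show "\<exists>c\<in>carrier G. \<forall>x. \<bar>\<phi> a x\<bar> \<le> \<phi> c x"
      using hd by blast
  qed
qed

text \<open>
  Each property of the coordinatewise order is inherited from the coordinates: antisymmetry from
  separation of points, directedness from absolute values being dominated, and the archimedean
  property from the field of coordinates.
\<close>

lemma (in comm_group) coordinatewise_order:
  fixes \<phi> :: "'a \<Rightarrow> 'i \<Rightarrow> 'k::archimedean_field"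
  assumes add: "\<And>a b x. a \<in> carrier G \<Longrightarrow> b \<in> carrier G \<Longrightarrow> \<phi> (a \<otimes> b) x = \<phi> a x + \<phi> b x"
    and sep: "\<And>a. a \<in> carrier G \<Longrightarrow> (\<And>x. \<phi> a x = 0) \<Longrightarrow> a = \<one>"
    and dom: "\<And>a. a \<in> carrier G \<Longrightarrow> \<exists>c\<in>carrier G. \<forall>x. \<bar>\<phi> a x\<bar> \<le> \<phi> c x"
  defines "r \<equiv> {(a, b). a \<in> carrier G \<and> b \<in> carrier G \<and> (\<forall>x. \<phi> a x \<le> \<phi> b x)}"
  shows "po_comm_group G r" and "directed_order_on (carrier G) r" and "archimedean_order G r"
proof -
  have one: "\<phi> \<one> x = 0" for x
    using add[of \<one> \<one> x] by simp
  have inv: "\<phi> (inv a) x = - \<phi> a x" if "a \<in> carrier G" for a x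
    using add[of a "inv a" x] that one by (simp add: eq_neg_iff_add_eq_0 add.commute)
  have inj: "a = b" if ab: "a \<in> carrier G" "b \<in> carrier G" and eq: "\<And>x. \<phi> a x = \<phi> b x" for a b
  proof -
    have "a \<otimes> inv b = \<one>"
      using ab by (intro sep) (simp_all add: add inv eq)
    then show ?thesis
      using ab by (metis inv_equality inv_inv inv_closed)
  qed
  show "po_comm_group G r"
  proof
    show "partial_order_on (carrier G) r"
      unfolding partial_order_on_def preorder_on_def
      by (intro conjI)
        (auto simp: r_def refl_on_def trans_def antisym_def intro: order_trans inj order.antisym)
    show "(a \<otimes> x, b \<otimes> x) \<in> r"
      if "a \<in> carrier G" "b \<in> carrier G" "x \<in> carrier G" "(a, b) \<in> r" for a b x
      using that by (auto simp: r_def add)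
  qed
  show "directed_order_on (carrier G) r"
    unfolding directed_order_on_def
  proof (intro ballI)
    fix a b assume ab: "a \<in> carrier G" "b \<in> carrier G"
    obtain c where c: "c \<in> carrier G" "\<And>x. \<bar>\<phi> a x\<bar> \<le> \<phi> c x"
      using dom[OF ab(1)] by blast
    obtain d where d: "d \<in> carrier G" "\<And>x. \<bar>\<phi> b x\<bar> \<le> \<phi> d x"
      using dom[OF ab(2)] by blast
    have "\<phi> a x \<le> \<phi> (c \<otimes> d) x \<and> \<phi> b x \<le> \<phi> (c \<otimes> d) x" for x
      using c(2)[of x] d(2)[of x] abs_le_D1 order_trans[OF abs_ge_zero]
      by (auto simp: add c(1) d(1) intro: add_increasing add_increasing2)
    then show "\<exists>c\<in>carrier G. (a, c) \<in> r \<and> (b, c) \<in> r"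
      using ab c(1) d(1) by (intro bexI[of _ "c \<otimes> d"]) (auto simp: r_def)
  qed
  show "archimedean_order G r"
    unfolding archimedean_order_def
  proof (intro ballI impI)
    fix a b assume a: "a \<in> carrier G" and b: "b \<in> carrier G" and inf: "infinitesimal_wrt G r a b"
    have nat_pow: "\<phi> (a [^] n) x = of_nat n * \<phi> a x" for n :: nat and x
      using a by (induction n) (simp_all add: one add algebra_simps)
    \<comment> \<open>A positive coordinate of \<open>a\<close> has a multiple exceeding the same coordinate of \<open>b\<close>.\<close>
    have "\<phi> a x = 0" for x
    proof (rule ccontr)
      assume "\<phi> a x \<noteq> 0"
      moreover have "\<phi> a x \<ge> 0"
        using inf by (auto simp: infinitesimal_wrt_def r_def one dest: spec[of _ x])
      ultimately have "\<phi> a x > 0" by simp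
      then obtain n where "\<phi> b x < of_nat n * \<phi> a x"
        using ex_less_of_nat_mult by blast
      moreover have "(a [^] int n, b) \<in> r"
        using inf unfolding infinitesimal_wrt_def by blast
      then have "\<phi> (a [^] n) x \<le> \<phi> b x"
        by (simp add: r_def int_pow_int)
      ultimately show False
        by (simp add: nat_pow)
    qed
    then show "a = \<one>"
      using sep a by blast
  qed
qed

theorem theorem34:
  fixes G :: "('a, 'b) monoid_scheme"
  assumes "comm_group G" and "torsion_free G"
  shows "\<exists>r. po_comm_group G r \<and> directed_order_on (carrier G) r \<and> archimedean_order G r"
proof -
  interpret comm_group G by fact
  obtain \<phi> :: "'a \<Rightarrow> 'a \<Rightarrow> rat" where
    "\<And>a b x. a \<in> carrier G \<Longrightarrow> b \<in> carrier G \<Longrightarrow> \<phi> (a \<otimes>\<^bsub>G\<^esub> b) x = \<phi> a x + \<phi> b x"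
    "\<And>a. a \<in> carrier G \<Longrightarrow> (\<And>x. \<phi> a x = 0) \<Longrightarrow> a = \<one>\<^bsub>G\<^esub>"
    "\<And>a. a \<in> carrier G \<Longrightarrow> \<exists>c\<in>carrier G. \<forall>x. \<bar>\<phi> a x\<bar> \<le> \<phi> c x"
    using rational_coordinates[OF assms(2)] by metis
  from coordinatewise_order[of \<phi>, OF this] show ?thesis
    by blast
qed

end
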